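(* Let $k\ge 2$ and $q\ge 1$ be integers and let $\mathbf{v}\in W_{k,q}$ be a vertex of $T_{k,q}$ lying in the interior of $R_{k,q}$ (i.e. $0<v_1<v_2<\cdots<v_{k-1}<q$). Then $\mathrm{link}_{T_{k,q}}(\mathbf{v})$ is isomorphic (as a simplicial complex) to the barycentric subdivision of the boundary of the $(k-1)$-simplex, i.e. $\mathrm{link}_{T_{k,q}}(\mathbf{v})\cong Sd(\partial\Delta^{k-1})=\Delta(\overline{B}_k)$.
   Context: $R_{k,q}=\{\mathbf{x}\in\mathbb{R}^{k-1}:0\le x_1\le\cdots\le x_{k-1}\le q\}$ is a $(k-1)$-simplex and $W_{k,q}=R_{k,q}\cap\mathbb{Z}^{k-1}$. A permutation $\pi=\pi_1\cdots\pi_{k-1}$ of $[k-1]$ is consistent with $\mathbf{v}\in W_{k,q}$ if $i$ appears before $i+1$ in $\pi$ whenever $v_i=v_{i+1}$. For such a pair, $F(\mathbf{v},\pi)$ is the simplex with vertices $\mathbf{v}^{(1)}=\mathbf{v}$ and $\mathbf{v}^{(m+1)}=\mathbf{v}^{(m)}+e_{\pi_{k-m}}$ for $m=1,\dots,k-1$ ($e_i$ the standard basis vectors of $\mathbb{R}^{k-1}$). The edgewise subdivision $T_{k,q}$ is the simplicial complex (a triangulation of $R_{k,q}$) with vertex set $W_{k,q}$ whose facets are all such $F(\mathbf{v},\pi)$. For a face $\sigma$ of a complex $K$, $\mathrm{link}_K(\sigma)=\{\tau\in K:\sigma\cup\tau\in K,\ \sigma\cap\tau=\emptyset\}$. $B_k$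 is the Boolean lattice of subsets of $[k]$, $\overline{B}_k=B_k\setminus\{\emptyset,[k]\}$, and $\Delta(P)$ denotes the order complex of a poset $P$ (faces are chains). *)

theory Defs
  imports "HOL-Analysis.Analysis" "HOL-Combinatorics.Permutations"
begin

section \<open>Abstract simplicial complexes\<close>

text \<open>
  A simplicial complex is represented by the set of its faces, the empty face included;
  its vertex set is the union of the faces.
\<close>

definition complex_iso :: "'a set set \<Rightarrow> 'b set set \<Rightarrow> bool" (infix "\<cong>\<^sub>c" 50) where
  "K \<cong>\<^sub>c L \<longleftrightarrow>
     (\<exists>f. bij_betw f (\<Union>K) (\<Union>L) \<and> (\<forall>\<sigma>. \<sigma> \<subseteq> \<Union>K \<longrightarrow> (\<sigma> \<in> K \<longleftrightarrow> f ` \<sigma> \<in> L)))"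

definition link :: "'a set set \<Rightarrow> 'a set \<Rightarrow> 'a set set" where
  "link K \<sigma> = {\<tau> \<in> K. \<sigma> \<union> \<tau> \<in> K \<and> \<sigma> \<inter> \<tau> = {}}"

definition order_complex :: "'a::order set \<Rightarrow> 'a set set" where
  "order_complex P = {C. C \<subseteq> P \<and> finite C \<and> Complete_Partial_Order.chain (\<le>) C}"

definition barycentric_subdivision :: "'a set set \<Rightarrow> 'a set set set" where
  "barycentric_subdivision K = order_complex (K - {{}})"

text \<open>The boundary of the $(k-1)$-simplex, whose $k$ vertices are labelled by $[k]$.\<close>

definition simplex_boundary :: "nat \<Rightarrow> nat set set" where
  "simplex_boundary k = Pow {1..k} - {{1..k}}"

definition boolean_lattice :: "nat \<Rightarrow> nat set set" where
  "boolean_lattice k = Pow {1..k}"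

definition proper_boolean_lattice :: "nat \<Rightarrow> nat set set" where
  "proper_boolean_lattice k = boolean_lattice k - {{}, {1..k}}"


section \<open>The edgewise subdivision\<close>

text \<open>
  A point of $\mathbb{R}^{k-1}$ is a function on \<open>{1..k-1}\<close>, extended by the value
  \<open>undefined\<close> to all natural numbers so that equality of points is equality of functions.
\<close>

abbreviation real_space :: "nat \<Rightarrow> (nat \<Rightarrow> real) topology" where
  "real_space k \<equiv> powertop_real {1..k - 1}"

definition simplex_R :: "nat \<Rightarrow> nat \<Rightarrow> (nat \<Rightarrow> real) set" where
  "simplex_R k q = {x \<in> topspace (real_space k).
     0 \<le> x 1 \<and> (\<forall>i. 1 \<le> i \<and> i + 1 \<le> k - 1 \<longrightarrow> x i \<le> x (i + 1)) \<and> x (k - 1) \<le> real q}"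

definition lattice_W :: "nat \<Rightarrow> nat \<Rightarrow> (nat \<Rightarrow> real) set" where
  "lattice_W k q = {x \<in> simplex_R k q. \<forall>i \<in> {1..k - 1}. x i \<in> \<int>}"

text \<open>
  The word $\pi_1 \cdots \pi_{k-1}$ is the function \<open>\<lambda>j. \<pi> j\<close>, so \<open>inv \<pi> i\<close> is the position of
  the letter \<open>i\<close>.
\<close>

definition consistent :: "nat \<Rightarrow> (nat \<Rightarrow> real) \<Rightarrow> (nat \<Rightarrow> nat) \<Rightarrow> bool" where
  "consistent k v \<pi> \<longleftrightarrow>
     (\<forall>i. 1 \<le> i \<and> i + 1 \<le> k - 1 \<and> v i = v (i + 1) \<longrightarrow> inv \<pi> i < inv \<pi> (i + 1))"

definition unit_vec :: "nat \<Rightarrow> nat \<Rightarrow> real" where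
  "unit_vec i = (\<lambda>j. if j = i then 1 else 0)"

text \<open>\<open>facet_vertex k v \<pi> m\<close> is $\mathbf{v}^{(m+1)}$, the index being shifted to start at 0.\<close>

primrec facet_vertex :: "nat \<Rightarrow> (nat \<Rightarrow> real) \<Rightarrow> (nat \<Rightarrow> nat) \<Rightarrow> nat \<Rightarrow> nat \<Rightarrow> real" where
  "facet_vertex k v \<pi> 0 = v"
| "facet_vertex k v \<pi> (Suc m) = (\<lambda>j. facet_vertex k v \<pi> m j + unit_vec (\<pi> (k - Suc m)) j)"

definition facet :: "nat \<Rightarrow> (nat \<Rightarrow> real) \<Rightarrow> (nat \<Rightarrow> nat) \<Rightarrow> (nat \<Rightarrow> real) set" where
  "facet k v \<pi> = facet_vertex k v \<pi> ` {0..k - 1}"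

text \<open>
  If $v_{k-1} = q$, then the last coordinate of the last vertex of $F(\mathbf{v},\pi)$ is $q+1$.
  Such simplices leave $R_{k,q}$ and are not part of its triangulation, whose vertex set is
  $W_{k,q}$; the condition \<open>facet k v \<pi> \<subseteq> lattice_W k q\<close> excludes exactly these.
\<close>

definition edgewise_subdivision :: "nat \<Rightarrow> nat \<Rightarrow> (nat \<Rightarrow> real) set set" where
  "edgewise_subdivision k q = {\<sigma>. \<exists>v \<pi>. v \<in> lattice_W k q \<and> \<pi> permutes {1..k - 1} \<and> consistent k v \<pi> \<and>
                 facet k v \<pi> \<subseteq> lattice_W k q \<and> \<sigma> \<subseteq> facet k v \<pi>}"

lemma interior_simplex_R:
  assumes "k \<ge> 2"
  shows "real_space k interior_of simplex_R k q =
    {x \<in> topspace (real_space k).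
       0 < x 1 \<and> (\<forall>i. 1 \<le> i \<and> i + 1 \<le> k - 1 \<longrightarrow> x i < x (i + 1)) \<and> x (k - 1) < real q}"
    (is "?I = ?S")
proof
  let ?X = "real_space k"
  have cont: "continuous_map ?X euclideanreal (\<lambda>x. x i)" if "i \<in> {1..k-1}" for i
    using that by (rule continuous_map_product_projection)
  have 1: "openin ?X {x \<in> topspace ?X. 0 < x 1}"
    using openin_continuous_map_preimage[OF cont[of 1], of "{0<..}"] assms by simp
  have 2: "openin ?X {x \<in> topspace ?X. x (k - 1) < real q}"
    using openin_continuous_map_preimage[OF cont[of "k-1"], of "{..<real q}"] assms by simp
  have 3: "openin ?X {x \<in> topspace ?X. x i < x (i + 1)}" if "i \<in> {1..<k-1}" for i
  proof -
    have "continuous_map ?X euclideanreal (\<lambda>x. x (i+1) - x i)"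
      using that by (intro continuous_map_diff cont) auto
    from openin_continuous_map_preimage[OF this, of "{0<..}"] show ?thesis
      by simp
  qed
  let ?J = "(\<lambda>i. {x \<in> topspace ?X. x i < x (i + 1)}) ` {1..<k-1}"
  have "openin ?X (topspace ?X \<inter> \<Inter>?J)"
  proof (cases "?J = {}")
    case False
    then show ?thesis
      by (intro openin_Int openin_topspace openin_Inter) (use 3 in auto)
  next
    case True
    then show ?thesis by (metis Inf_empty Int_UNIV_right openin_topspace)
  qed
  then have "openin ?X ({x \<in> topspace ?X. 0 < x 1} \<inter> (topspace ?X \<inter> \<Inter>?J)
       \<inter> {x \<in> topspace ?X. x (k - 1) < real q})"
    using 1 2 by (metis (no_types, lifting) openin_Int)
  also have "{x \<in> topspace ?X. 0 < x 1} \<inter> (topspace ?X \<inter> \<Inter>?J)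
       \<inter> {x \<in> topspace ?X. x (k - 1) < real q} = ?S"
    using assms by (auto simp: topspace_product_topology)
  finally have "openin ?X ?S" .
  moreover have "?S \<subseteq> simplex_R k q"
    unfolding simplex_R_def by (auto intro: less_imp_le)
  ultimately show "?S \<subseteq> ?I" by (rule interior_of_maximal[rotated])
next
  let ?X = "real_space k"
  show "?I \<subseteq> ?S"
  proof
    fix x assume x: "x \<in> ?I"
    obtain T where T: "openin ?X T" "x \<in> T" "T \<subseteq> simplex_R k q"
      using x by (auto simp: interior_of_def)
    have xt: "x \<in> topspace ?X" using T openin_subset by blast
    obtain U where U: "\<And>i. openin euclideanreal (U i)" "x \<in> PiE {1..k-1} U" "PiE {1..k-1} U \<subseteq> T"
      using product_topology_open_contains_basis[OF T(1,2)] by blast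
    have pert: "\<exists>e>0. x(i := x i + e) \<in> simplex_R k q \<and> x(i := x i - e) \<in> simplex_R k q" if i: "i \<in> {1..k-1}" for i
    proof -
      have "open (U i)" "x i \<in> U i" using U(1)[of i] U(2) i by (auto simp: PiE_iff)
      then obtain d where d: "d > 0" "\<And>y. dist y (x i) < d \<Longrightarrow> y \<in> U i"
        unfolding open_dist by blast
      have "x(i := y) \<in> simplex_R k q" if "y \<in> U i" for y
      proof -
        have "x(i := y) \<in> PiE {1..k-1} U"
          using U(2) that i by (auto simp: PiE_iff extensional_def)
        then show ?thesis using U(3) T(3) by blast
      qed
      with d show ?thesis
        by (intro exI[of _ "d/2"]) (auto simp: dist_real_def)
    qed
    have a: "0 < x 1"
    proof -
      obtain e where "e > 0" "x(1 := x 1 - e) \<in> simplex_R k q" using pert[of 1] assms by force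
      then show ?thesis by (auto simp: simplex_R_def)
    qed
    have b: "x (k - 1) < real q"
    proof -
      obtain e where "e > 0" "x(k-1 := x (k-1) + e) \<in> simplex_R k q" using pert[of "k-1"] assms by force
      then show ?thesis by (auto simp: simplex_R_def)
    qed
    have c: "x i < x (i + 1)" if i: "1 \<le> i \<and> i + 1 \<le> k - 1" for i
    proof -
      obtain e where e: "e > 0" "x(i := x i + e) \<in> simplex_R k q" using pert[of i] i by force
      then have "(x(i := x i + e)) i \<le> (x(i := x i + e)) (i + 1)"
        using i unfolding simplex_R_def by blast
      then show ?thesis using e by simp
    qed
    show "x \<in> ?S" using a b c xt by blast
  qed
qed

end

theory Submission imports Defs begin

text \<open>
  A neighbour of \<open>v\<close> in a common facet is \<open>v + 1\<^sub>A\<close> or \<open>v - 1\<^sub>B\<close> with nonempty \<open>A, B \<subseteq> [k-1]\<close>.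
  Sending it to \<open>A\<close> respectively \<open>[k] - B\<close> gives a bijection onto the proper nonempty subsets
  of \<open>[k]\<close>. The vertices of a facet through \<open>v\<close> are \<open>v - 1\<^sub>X + 1\<^sub>Y\<close>, where \<open>X\<close> is fixed
  and \<open>Y\<close> runs through a maximal chain of subsets of \<open>[k-1]\<close> containing \<open>X\<close>; starting this
  chain at \<open>X\<close> and reading it cyclically gives a chain of subsets of \<open>[k]\<close>. As \<open>v\<close>
  is interior, none of these simplices leaves the region.
\<close>

section \<open>Isomorphisms onto order complexes\<close>

text \<open>Injectivity on vertices recovers a simplex from its image, so the inverse of
  \<open>g\<close> is an isomorphism. This reduces the theorem to an equality of sets of
  faces.\<close>

lemma complex_iso_image:
  assumes "inj_on g (\<Union>L)"
  shows "(`) g ` L \<cong>\<^sub>c L"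
proof -
  let ?f = "inv_into (\<Union>L) g"
  have U: "\<Union>((`) g ` L) = g ` \<Union>L" by auto
  have iff: "\<sigma> \<in> (`) g ` L \<longleftrightarrow> ?f ` \<sigma> \<in> L" if \<sigma>: "\<sigma> \<subseteq> g ` \<Union>L" for \<sigma>
  proof -
    obtain C where C: "C \<subseteq> \<Union>L" "\<sigma> = g ` C" using \<sigma> by (rule subset_imageE)
    have "g ` C \<in> (`) g ` L \<longleftrightarrow> C \<in> L"
    proof
      assume "g ` C \<in> (`) g ` L"
      then obtain D where D: "g ` C = g ` D" "D \<in> L" by (rule imageE)
      have "C = D" using D(1) inj_on_image_eq_iff[OF assms C(1) Union_upper[OF D(2)]] by (rule iffD1[rotated])
      with D(2) show "C \<in> L" by (simp only:)
    qed (rule imageI)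
    then show ?thesis by (simp only: C(2) inv_into_image_cancel[OF assms C(1)])
  qed
  have "bij_betw ?f (g ` \<Union>L) (\<Union>L)"
    using assms by (intro bij_betw_inv_into inj_on_imp_bij_betw)
  with iff show ?thesis
    unfolding complex_iso_def U by (intro exI[of _ ?f] conjI allI impI)
qed

lemma Union_order_complex: "\<Union>(order_complex P) = P"
proof
  show "P \<subseteq> \<Union>(order_complex P)"
  proof
    fix x assume "x \<in> P"
    then have "{x} \<in> order_complex P"
      by (auto simp: order_complex_def Complete_Partial_Order.chain_def)
    then show "x \<in> \<Union>(order_complex P)" by blast
  qed
qed (auto simp: order_complex_def)

section \<open>Chains of subsets as suffixes of a word\<close>

text \<open>Sorting by the number of members of \<open>D\<close> containing an element pushes the
  smaller members of the chain to the end of the list.\<close>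

lemma subset_chain_enumeration:
  fixes V :: "'a::linorder set"
  assumes "finite V" "\<And>X. X \<in> D \<Longrightarrow> X \<subseteq> V" "\<And>X Y. X \<in> D \<Longrightarrow> Y \<in> D \<Longrightarrow> X \<subseteq> Y \<or> Y \<subseteq> X"
  shows "\<exists>xs. distinct xs \<and> set xs = V \<and> (\<forall>X\<in>D. \<exists>m. X = set (drop m xs))"
proof -
  define key where "key x = card {X \<in> D. x \<in> X}" for x
  define xs where "xs = sort_key key (sorted_list_of_set V)"
  have finD: "finite D"
    by (rule finite_subset[of _ "Pow V"]) (use assms in auto)
  have up: "y \<in> X" if "X \<in> D" "x \<in> X" "key x \<le> key y" for x y X
  proof (rule ccontr)
    assume "y \<notin> X"
    \<comment> \<open>A member containing \<open>y\<close> is not inside \<open>X\<close>, hence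
      contains \<open>X\<close> and so \<open>x\<close>. The inclusion is strict because
      \<open>X\<close> itself contains \<open>x\<close> but not \<open>y\<close>.\<close>
    then have "{Z \<in> D. y \<in> Z} \<subset> {Z \<in> D. x \<in> Z}"
      using that assms(3)[of X] by blast
    then have "key y < key x"
      unfolding key_def using finD by (intro psubset_card_mono) auto
    with that show False by simp
  qed
  have xs: "distinct xs" "set xs = V" "sorted (map key xs)"
    using assms(1) by (auto simp: xs_def)
  \<comment> \<open>The cut is just before the first element of \<open>X\<close>; later elements
    have at least its key, so \<open>up\<close> places them in \<open>X\<close>.\<close>
  have "X = set (drop (length (takeWhile (\<lambda>x. x \<notin> X) xs)) xs)" if X: "X \<in> D" for X
  proof -
    define ys where "ys = dropWhile (\<lambda>x. x \<notin> X) xs"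
    have xs_eq: "takeWhile (\<lambda>x. x \<notin> X) xs @ ys = xs" by (simp add: ys_def)
    have "X \<subseteq> set ys"
    proof
      fix x assume "x \<in> X"
      then have "x \<in> set (takeWhile (\<lambda>x. x \<notin> X) xs @ ys)"
        unfolding xs_eq using assms(2)[OF X] xs(2) by blast
      with \<open>x \<in> X\<close> show "x \<in> set ys" by (auto dest: set_takeWhileD)
    qed
    moreover have "set ys \<subseteq> X"
    proof (cases ys)
      case (Cons y zs)
      then have "y \<in> X" using hd_dropWhile[of "\<lambda>x. x \<notin> X" xs] by (auto simp: ys_def)
      moreover have "sorted (map key ys)"
        using xs(3) by (metis xs_eq map_append sorted_append)
      ultimately show ?thesis using up[OF X] Cons by auto
    qed simp
    moreover have "ys = drop (length (takeWhile (\<lambda>x. x \<notin> X) xs)) xs"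
      by (simp add: ys_def dropWhile_eq_drop)
    ultimately show ?thesis by simp
  qed
  with xs show ?thesis by blast
qed

text \<open>\<open>facet_vertex\<close> consumes the word from its end, so a chain has to be
  realised by suffixes; here \<open>m\<close> counts the letters kept.\<close>

lemma subset_chain_permutation:
  assumes "\<And>X. X \<in> D \<Longrightarrow> X \<subseteq> {1..n}" "\<And>X Y. X \<in> D \<Longrightarrow> Y \<in> D \<Longrightarrow> X \<subseteq> Y \<or> Y \<subseteq> X"
  shows "\<exists>\<pi>. \<pi> permutes {1..n::nat} \<and> (\<forall>X\<in>D. \<exists>m\<le>n. X = \<pi> ` {Suc n - m..<Suc n})"
proof -
  have "\<exists>xs. distinct xs \<and> set xs = {1..n} \<and> (\<forall>X\<in>D. \<exists>m. X = set (drop m xs))"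
    by (rule subset_chain_enumeration) (rule finite_atLeastAtMost, (rule assms, assumption+)+)
  then obtain xs where xs: "distinct xs" "set xs = {1..n}" "\<forall>X\<in>D. \<exists>m. X = set (drop m xs)"
    by (elim exE conjE)
  have len: "length xs = n" using distinct_card[OF xs(1)] xs(2) by simp
  \<comment> \<open>Letters are numbered from 1, list entries from 0; \<open>permutes\<close>
    demands the identity outside \<open>{1..n}\<close>.\<close>
  define \<pi> where "\<pi> i = (if i \<in> {1..n} then xs ! (i - 1) else i)" for i
  have drop: "\<pi> ` {Suc m..<Suc n} = set (drop m xs)" for m
  proof -
    have "drop m xs = drop m (map ((!) xs) [0..<n])"
      using map_nth[of xs] unfolding len by (rule arg_cong[OF sym])
    also have "\<dots> = map ((!) xs) [m..<n]" by (simp add: drop_map)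
    finally have "set (drop m xs) = (!) xs ` {m..<n}" by simp
    also have "\<dots> = (\<lambda>i. xs ! (i - 1)) ` Suc ` {m..<n}" by (simp only: image_image diff_Suc_1)
    also have "\<dots> = \<pi> ` {Suc m..<Suc n}"
      unfolding image_Suc_atLeastLessThan by (rule image_cong) (auto simp: \<pi>_def)
    finally show ?thesis by simp
  qed
  have "\<pi> ` {1..n} = {1..n}"
    using drop[of 0] xs(2) by (simp add: atLeastLessThanSuc_atLeastAtMost)
  then have "bij_betw \<pi> {1..n} {1..n}"
    by (simp add: bij_betw_def eq_card_imp_inj_on)
  then have perm: "\<pi> permutes {1..n}" by (rule bij_imp_permutes) (auto simp: \<pi>_def)
  \<comment> \<open>Dropping \<open>m\<close> entries keeps \<open>n - m\<close>; for
    \<open>m > n\<close> truncated subtraction yields the empty suffix.\<close>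
  have "\<exists>m\<le>n. X = \<pi> ` {Suc n - m..<Suc n}" if X: "X \<in> D" for X
  proof -
    obtain m where "X = set (drop m xs)" using xs(3) X by blast
    moreover have "{Suc n - (n - m)..<Suc n} = {Suc m..<Suc n}" by auto
    ultimately have "X = \<pi> ` {Suc n - (n - m)..<Suc n}" by (simp only: drop)
    then show ?thesis by (intro exI[of _ "n - m"] conjI) simp_all
  qed
  with perm show ?thesis by blast
qed

section \<open>Vertices of a facet\<close>

text \<open>The letters used in the first \<open>m\<close> steps are distinct, so no coordinate is
  raised twice and the total increment is an indicator.\<close>

lemma facet_vertex_eq:
  assumes "\<pi> permutes {1..k - 1}" "m < k"
  shows "facet_vertex k u \<pi> m j = u j + of_bool (j \<in> \<pi> ` {k - m..<k})"
  using assms(2)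
proof (induction m)
  case (Suc m)
  let ?T = "\<pi> ` {k - m..<k}"
  have "{k - Suc m..<k} = insert (k - Suc m) {k - m..<k}" using Suc.prems by auto
  then have T: "\<pi> ` {k - Suc m..<k} = insert (\<pi> (k - Suc m)) ?T" by (simp only: image_insert)
  have notin: "\<pi> (k - Suc m) \<notin> ?T"
    using inj_image_mem_iff[OF permutes_inj[OF assms(1)]] Suc.prems by simp
  have IH: "facet_vertex k u \<pi> m j = u j + of_bool (j \<in> ?T)"
    using Suc.prems by (intro Suc.IH) simp
  show ?case
    unfolding facet_vertex.simps IH T unit_vec_def using notin
    by (cases "j = \<pi> (k - Suc m)") (simp_all only: insert_iff, simp_all)
qed simp

lemma facet_memD:
  assumes "x \<in> facet k u \<pi>" "k \<ge> 2"
  shows "\<exists>m<k. x = facet_vertex k u \<pi> m"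
proof -
  obtain m where "m \<in> {0..k - 1}" "x = facet_vertex k u \<pi> m"
    using assms(1) unfolding facet_def by (rule imageE)
  with assms(2) show ?thesis by (intro exI[of _ m]) auto
qed

section \<open>Neighbours of an interior vertex and their labels\<close>

text \<open>This is addition of the indicator of \<open>A\<close> in R^k modulo the all-ones vector,
  normalised so that coordinate \<open>k\<close> stays fixed.\<close>

definition neighbour :: "nat \<Rightarrow> (nat \<Rightarrow> real) \<Rightarrow> nat set \<Rightarrow> nat \<Rightarrow> real" where
  "neighbour k v A =
     (\<lambda>j. if k \<in> A then v j - of_bool (j \<in> {1..k} - A) else v j + of_bool (j \<in> A))"

text \<open>A nonempty set without \<open>k\<close> raises some coordinate, a set with
  \<open>k\<close> raises none; within each kind the moved coordinates determine the set.\<close>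

lemma neighbour_inj: "inj_on (neighbour k v) (proper_boolean_lattice k)"
proof (rule inj_onI)
  fix A B assume AB: "A \<in> proper_boolean_lattice k" "B \<in> proper_boolean_lattice k"
    and eq: "neighbour k v A = neighbour k v B"
  have P: "A \<subseteq> {1..k}" "B \<subseteq> {1..k}" "A \<noteq> {}" "B \<noteq> {}" "A \<noteq> {1..k}" "B \<noteq> {1..k}"
    using AB by (auto simp: proper_boolean_lattice_def boolean_lattice_def)
  have eqj: "neighbour k v A j = neighbour k v B j" for j using eq by simp
  consider "k \<in> A" "k \<in> B" | "k \<notin> A" "k \<notin> B" | "k \<in> A" "k \<notin> B" | "k \<notin> A" "k \<in> B" by blast
  then show "A = B"
  proof cases
    case 1
    have "j \<in> {1..k} - A \<longleftrightarrow> j \<in> {1..k} - B" for j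
      using eqj[of j] 1 by (simp add: neighbour_def of_bool_eq_iff)
    then have "{1..k} - A = {1..k} - B" by (rule set_eqI)
    with P show ?thesis by blast
  next
    case 2
    have "j \<in> A \<longleftrightarrow> j \<in> B" for j
      using eqj[of j] 2 by (simp add: neighbour_def of_bool_eq_iff)
    then show ?thesis by (rule set_eqI)
  next
    case 3
    obtain j where "j \<in> B" using P by blast
    with eqj[of j] 3 show ?thesis by (simp add: neighbour_def of_bool_def split: if_splits)
  next
    case 4
    obtain j where "j \<in> A" using P by blast
    with eqj[of j] 4 show ?thesis by (simp add: neighbour_def of_bool_def split: if_splits)
  qed
qed

lemma neighbour_neq:
  assumes "A \<in> proper_boolean_lattice k"
  shows "neighbour k v A \<noteq> v"
proof
  assume eq: "neighbour k v A = v"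
  have A: "A \<subseteq> {1..k}" "A \<noteq> {}" "A \<noteq> {1..k}"
    using assms by (auto simp: proper_boolean_lattice_def boolean_lattice_def)
  have eqj: "neighbour k v A j = v j" for j using eq by simp
  show False
  proof (cases "k \<in> A")
    case True
    obtain j where "j \<in> {1..k} - A" using A by blast
    with eqj[of j] True show ?thesis by (simp add: neighbour_def)
  next
    case False
    obtain j where "j \<in> A" using A by blast
    with eqj[of j] False show ?thesis by (simp add: neighbour_def)
  qed
qed

text \<open>At an interior lattice point consecutive coordinates, and the bounds 0 and
  \<open>q\<close>, are at least 1 apart, which leaves room for the shift.\<close>

lemma lattice_W_shift:
  assumes k: "k \<ge> 2" and W: "v \<in> lattice_W k q"
    and I: "v \<in> real_space k interior_of simplex_R k q"
    and XY: "X \<subseteq> Y \<or> Y \<subseteq> X" "X \<subseteq> {1..k - 1}" "Y \<subseteq> {1..k - 1}"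
  shows "(\<lambda>j. v j - of_bool (j \<in> X) + of_bool (j \<in> Y)) \<in> lattice_W k q"
proof -
  define d :: "nat \<Rightarrow> real" where "d j = of_bool (j \<in> Y) - of_bool (j \<in> X)" for j
  have int: "v i \<in> \<int>" if "i \<in> {1..k - 1}" for i using W that by (simp add: lattice_W_def)
  have gap: "a + 1 \<le> b" if "a \<in> \<int>" "b \<in> \<int>" "a < b" for a b :: real
    using that by (auto elim!: Ints_cases)
  have v: "v \<in> topspace (real_space k)" "0 < v 1" "v (k - 1) < real q"
    "\<And>i. 1 \<le> i \<Longrightarrow> i + 1 \<le> k - 1 \<Longrightarrow> v i < v (i + 1)"
    using I unfolding interior_simplex_R[OF k] by auto
  have "0 + 1 \<le> v 1" "v (k - 1) + 1 \<le> real q"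
    using v k by (auto intro!: gap int simp del: add_0)
  moreover have "v i + 1 \<le> v (i + 1)" if "1 \<le> i" "i + 1 \<le> k - 1" for i
    using v(4)[OF that] that by (intro gap int) auto
  \<comment> \<open>Comparability of \<open>X\<close> and \<open>Y\<close> excludes entries of
    opposite sign in \<open>d\<close>, so any two entries differ by at most 1.\<close>
  moreover have "d i \<le> 1 + d j" "- 1 \<le> d i" "d i \<le> 1" "d i \<in> \<int>" for i j
    using XY(1) by (auto simp: d_def of_bool_def)
  moreover have "(\<lambda>j. v j + d j) \<in> topspace (real_space k)"
    using v(1) XY(2,3) by (auto simp: d_def PiE_iff extensional_def)
  moreover have "v i + d i \<in> \<int>" if "i \<in> {1..k - 1}" for i
    using int[OF that] \<open>d i \<in> \<int>\<close> by (rule Ints_add)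
  ultimately have "(\<lambda>j. v j + d j) \<in> lattice_W k q"
    unfolding lattice_W_def simplex_R_def mem_Collect_eq by (smt (verit))
  then show ?thesis by (simp add: d_def algebra_simps)
qed

text \<open>\<open>X\<close> is the place of \<open>v\<close> in the chain of a facet,
  \<open>Y\<close> that of another vertex. Reading cyclically from \<open>X\<close>, the labels grow
  to \<open>[k-1] - X\<close>; then \<open>k\<close> enters and the sets below \<open>X\<close> are
  added to \<open>[k] - X\<close>.\<close>

definition chain_label :: "nat \<Rightarrow> nat set \<Rightarrow> nat set \<Rightarrow> nat set" where
  "chain_label k X Y = (if X \<subseteq> Y then Y - X else {1..k} - (X - Y))"

lemma neighbour_chain_label:
  assumes "k \<ge> 2" "X \<subseteq> Y \<or> Y \<subseteq> X" "X \<subseteq> {1..k - 1}" "Y \<subseteq> {1..k - 1}"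
  shows "neighbour k v (chain_label k X Y) = (\<lambda>j. v j - of_bool (j \<in> X) + of_bool (j \<in> Y))"
proof (cases "X \<subseteq> Y")
  case True
  then have "k \<notin> chain_label k X Y" using assms by (auto simp: chain_label_def)
  with True show ?thesis
    by (intro ext) (auto simp: neighbour_def chain_label_def of_bool_def)
next
  case False
  then have "k \<in> chain_label k X Y" using assms by (auto simp: chain_label_def)
  moreover have "{1..k} - chain_label k X Y = X - Y"
  proof -
    have "{1..k - 1} \<subseteq> {1..k}" by auto
    with assms(3) have "X - Y \<subseteq> {1..k}" by blast
    with False show ?thesis by (simp only: chain_label_def if_False double_diff[OF _ subset_refl])
  qed
  ultimately show ?thesis
    using False assms(2) by (intro ext) (auto simp: neighbour_def of_bool_def)
qed

text \<open>\<open>X \<noteq> Y\<close> excludes the empty set in the first branch and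
  \<open>[k]\<close> in the second; the absence or presence of \<open>k\<close> excludes the other
  extreme.\<close>

lemma chain_label_mem:
  assumes "k \<ge> 2" "X \<subseteq> Y \<or> Y \<subseteq> X" "X \<noteq> Y" "X \<subseteq> {1..k - 1}" "Y \<subseteq> {1..k - 1}"
  shows "chain_label k X Y \<in> proper_boolean_lattice k"
proof -
  have "k \<in> {1..k}" "k \<notin> X" "k \<notin> Y" using assms by auto
  moreover have "X \<subseteq> {1..k}" "Y \<subseteq> {1..k}" using assms by auto
  ultimately show ?thesis
    using assms(2,3) unfolding chain_label_def proper_boolean_lattice_def boolean_lattice_def
    by (cases "X \<subseteq> Y") (simp_all del: atLeastAtMost_iff, blast+)
qed

section \<open>From simplices of the link to chains\<close>

lemma link_simplex_as_neighbours:
  assumes k: "k \<ge> 2" and \<tau>: "\<tau> \<in> link (edgewise_subdivision k q) {v}"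
  shows "\<tau> \<in> (`) (neighbour k v) ` order_complex (proper_boolean_lattice k)"
proof -
  obtain u \<pi> where \<pi>: "\<pi> permutes {1..k - 1}" and sub: "insert v \<tau> \<subseteq> facet k u \<pi>" and "v \<notin> \<tau>"
    using \<tau> by (auto simp: link_def edgewise_subdivision_def)
  define S where "S m = \<pi> ` {k - m..<k}" for m
  have fv: "facet_vertex k u \<pi> m = (\<lambda>j. u j + of_bool (j \<in> S m))" if "m < k" for m
    using facet_vertex_eq[OF \<pi> that] by (auto simp: S_def)
  have mono: "S m \<subseteq> S n \<or> S n \<subseteq> S m" for m n
    unfolding S_def by (cases "m \<le> n") (auto intro!: image_mono)
  have S_sub: "S m \<subseteq> {1..k - 1}" if "m < k" for m
  proof -
    have "S m \<subseteq> \<pi> ` {1..k - 1}" unfolding S_def using that by (intro image_mono) auto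
    then show ?thesis using permutes_image[OF \<pi>] by simp
  qed
  have idx: "\<exists>m<k. x = facet_vertex k u \<pi> m" if "x \<in> insert v \<tau>" for x
    using that sub by (intro facet_memD[OF _ k]) blast
  \<comment> \<open>\<open>p\<close> is the position of \<open>v\<close> in the facet; measured from
    \<open>v\<close>, the vertex at \<open>m\<close> is displaced by the indicator of
    \<open>S m\<close> minus that of \<open>S p\<close>.\<close>
  obtain p where p: "p < k" "v = (\<lambda>j. u j + of_bool (j \<in> S p))"
    using idx[of v] fv by auto
  define I where "I = {m. m < k \<and> facet_vertex k u \<pi> m \<in> \<tau>}"
  define A where "A m = chain_label k (S p) (S m)" for m
  have nb: "neighbour k v (A m) = facet_vertex k u \<pi> m" if "m < k" for m
    unfolding A_def neighbour_chain_label[OF k mono S_sub[OF p(1)] S_sub[OF that]] fv[OF that]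
    by (simp add: p(2))
  have "\<tau> = facet_vertex k u \<pi> ` I" using idx by (auto simp: I_def)
  also have "\<dots> = neighbour k v ` (A ` I)"
    unfolding image_image by (rule image_cong) (auto simp: nb I_def)
  finally have \<tau>_eq: "\<tau> = neighbour k v ` (A ` I)" .
  have "A m \<in> proper_boolean_lattice k" if "m \<in> I" for m
  proof -
    have "m < k" "S p \<noteq> S m"
      using that \<open>v \<notin> \<tau>\<close> p fv[of m] by (auto simp: I_def)
    then show ?thesis
      unfolding A_def using k mono S_sub p(1) by (intro chain_label_mem) auto
  qed
  \<comment> \<open>On one side of \<open>S p\<close> the labels are nested like the sets
    \<open>S m\<close>; across it, the label without \<open>k\<close> lies in
    \<open>[k] - S p\<close>, hence in the one with \<open>k\<close>.\<close>
  moreover have "A m \<subseteq> A n \<or> A n \<subseteq> A m" if "m \<in> I" "n \<in> I" for m n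
  proof -
    have "S m \<subseteq> {1..k}" "S n \<subseteq> {1..k}"
      using S_sub[of m] S_sub[of n] that by (fastforce simp: I_def)+
    then show ?thesis
      using mono[of m n] mono[of m p] mono[of n p] unfolding A_def chain_label_def by auto
  qed
  ultimately have "A ` I \<in> order_complex (proper_boolean_lattice k)"
    by (auto simp: order_complex_def Complete_Partial_Order.chain_def I_def)
  with \<tau>_eq show ?thesis by blast
qed

lemma subset_atLeastAtMost_pred:
  assumes "n \<notin> A" "A \<subseteq> {m..n::nat}"
  shows "A \<subseteq> {m..n - 1}"
proof
  fix x assume "x \<in> A"
  with assms have "x \<noteq> n" "x \<in> {m..n}" by blast+
  then show "x \<in> {m..n - 1}" by auto
qed

section \<open>From chains to simplices of the link\<close>

lemma neighbour_simplex_in_link: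
  assumes k: "k \<ge> 2" and W: "v \<in> lattice_W k q"
    and I: "v \<in> real_space k interior_of simplex_R k q"
    and C: "C \<in> order_complex (proper_boolean_lattice k)"
  shows "neighbour k v ` C \<in> link (edgewise_subdivision k q) {v}"
proof -
  have P: "A \<subseteq> {1..k}" "A \<noteq> {}" "A \<noteq> {1..k}" "A \<in> proper_boolean_lattice k" if "A \<in> C" for A
    using C that by (auto simp: order_complex_def proper_boolean_lattice_def boolean_lattice_def)
  have cmp: "A \<subseteq> B \<or> B \<subseteq> A" if "A \<in> C" "B \<in> C" for A B
    using C that by (auto simp: order_complex_def Complete_Partial_Order.chain_def)
  \<comment> \<open>The coordinates lowered by some member of \<open>C\<close>. If no member
    contains \<open>k\<close>, the intersection is \<open>UNIV\<close> and \<open>X\<close> is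
    empty.\<close>
  define X where "X = {1..k} - \<Inter>{A \<in> C. k \<in> A}"
  \<comment> \<open>Chosen to invert \<open>chain_label k X\<close> on \<open>C\<close>.\<close>
  define Y where "Y A = (if k \<in> A then X \<inter> A else X \<union> A)" for A
  have "k \<notin> X" "X \<subseteq> {1..k}" by (auto simp: X_def)
  then have X_sub: "X \<subseteq> {1..k - 1}" by (rule subset_atLeastAtMost_pred)
  have Y_sub: "Y A \<subseteq> {1..k - 1}" if "A \<in> C" for A
  proof (cases "k \<in> A")
    case True
    then show ?thesis using X_sub by (auto simp: Y_def)
  next
    case False
    with subset_atLeastAtMost_pred[OF False P(1)[OF that]] X_sub show ?thesis
      by (simp add: Y_def)
  qed
  \<comment> \<open>By comparability a member without \<open>k\<close> lies inside every member with
    \<open>k\<close>, hence inside their intersection.\<close>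
  have disj: "X \<inter> A = {}" if "A \<in> C" "k \<notin> A" for A
    using cmp[OF that(1)] that by (auto simp: X_def)
  have cov: "{1..k} - A \<subseteq> X" if "A \<in> C" "k \<in> A" for A
    using that by (auto simp: X_def)
  have XY: "X \<subseteq> Y A \<or> Y A \<subseteq> X" for A by (auto simp: Y_def)
  have label: "chain_label k X (Y A) = A" if A: "A \<in> C" for A
  proof (cases "k \<in> A")
    case True
    then have "\<not> X \<subseteq> A" using cov[OF A True] P(1,3)[OF A] by blast
    with True show ?thesis
      using cov[OF A True] P(1)[OF A] by (auto simp: chain_label_def Y_def)
  next
    case False
    then show ?thesis using disj[OF A] by (auto simp: chain_label_def Y_def)
  qed
  have nb: "neighbour k v A = (\<lambda>j. v j - of_bool (j \<in> X) + of_bool (j \<in> Y A))" if "A \<in> C" for A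
    using neighbour_chain_label[OF k XY X_sub Y_sub[OF that], of v] label[OF that] by simp
  \<comment> \<open>In the mixed case \<open>X\<close> separates the two sets.\<close>
  have Ycmp: "Y A \<subseteq> Y B \<or> Y B \<subseteq> Y A" if "A \<in> C" "B \<in> C" for A B
    using cmp[OF that] by (auto simp: Y_def)
  have "\<exists>\<pi>. \<pi> permutes {1..k - 1} \<and>
      (\<forall>Z\<in>insert X (Y ` C). \<exists>m\<le>k - 1. Z = \<pi> ` {Suc (k - 1) - m..<Suc (k - 1)})"
  proof (rule subset_chain_permutation)
    show "Z \<subseteq> {1..k - 1}" if "Z \<in> insert X (Y ` C)" for Z
      using that X_sub Y_sub by blast
    show "Z \<subseteq> Z' \<or> Z' \<subseteq> Z" if "Z \<in> insert X (Y ` C)" "Z' \<in> insert X (Y ` C)" for Z Z'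
      using that XY Ycmp by blast
  qed
  then obtain \<pi> where \<pi>: "\<pi> permutes {1..k - 1}"
    and suffix: "\<forall>Z\<in>insert X (Y ` C). \<exists>m\<le>k - 1. Z = \<pi> ` {Suc (k - 1) - m..<Suc (k - 1)}"
    by (elim exE conjE)
  define S where "S m = \<pi> ` {k - m..<k}" for m
  have suff: "\<exists>m<k. Z = S m" if "Z \<in> insert X (Y ` C)" for Z
  proof -
    obtain m where "m \<le> k - 1" "Z = \<pi> ` {Suc (k - 1) - m..<Suc (k - 1)}"
      using bspec[OF suffix \<open>Z \<in> insert X (Y ` C)\<close>] by (elim exE conjE)
    with k show ?thesis by (intro exI[of _ m]) (simp add: S_def)
  qed
  obtain p where p: "p < k" "X = S p" using suff[of X] by auto
  \<comment> \<open>The lowest vertex of the facet: \<open>S 0\<close> is empty and gives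
    \<open>u\<close>, while \<open>S p = X\<close> gives back \<open>v\<close>.\<close>
  define u where "u j = v j - of_bool (j \<in> X)" for j
  have fv: "facet_vertex k u \<pi> m = (\<lambda>j. v j - of_bool (j \<in> X) + of_bool (j \<in> S m))" if "m < k" for m
    using facet_vertex_eq[OF \<pi> that] by (auto simp: S_def u_def)
  have mem: "(\<lambda>j. v j - of_bool (j \<in> X) + of_bool (j \<in> S m)) \<in> facet k u \<pi>" if "m < k" for m
    unfolding facet_def fv[OF that, symmetric] using that by (intro imageI) auto
  have S_sub: "S m \<subseteq> {1..k - 1}" if "m < k" for m
  proof -
    have "S m \<subseteq> \<pi> ` {1..k - 1}" unfolding S_def using that by (intro image_mono) auto
    then show ?thesis using permutes_image[OF \<pi>] by simp
  qed
  have mono: "S m \<subseteq> S n \<or> S n \<subseteq> S m" for m n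
    unfolding S_def by (cases "m \<le> n") (auto intro!: image_mono)
  have facetW: "facet k u \<pi> \<subseteq> lattice_W k q"
  proof
    fix x assume "x \<in> facet k u \<pi>"
    then obtain m where "m < k" "x = facet_vertex k u \<pi> m" using facet_memD[OF _ k] by blast
    then show "x \<in> lattice_W k q"
      using fv lattice_W_shift[OF k W I _ X_sub S_sub[of m]] mono[of p m] p(2) by simp
  qed
  \<comment> \<open>Together with \<open>facetW\<close> this puts \<open>u\<close> in
    \<open>lattice_W k q\<close>.\<close>
  moreover have "u \<in> facet k u \<pi>"
    unfolding facet_def by (rule image_eqI[of _ _ 0]) auto
  moreover have "consistent k u \<pi>"
    unfolding consistent_def
  proof (intro allI impI)
    fix i assume i: "1 \<le> i \<and> i + 1 \<le> k - 1 \<and> u i = u (i + 1)"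
    have "v i < v (i + 1)"
      using I i unfolding interior_simplex_R[OF k] by blast
    \<comment> \<open>Equality in \<open>u\<close> after strict increase in \<open>v\<close> means
      that only coordinate \<open>i + 1\<close> was lowered. The letters in \<open>X\<close> fill
      the last \<open>p\<close> positions, so \<open>i\<close> precedes
      \<open>i + 1\<close>.\<close>
    with i have "i \<notin> X" "i + 1 \<in> X" by (auto simp: u_def of_bool_def split: if_splits)
    then obtain n where n: "n \<in> {k - p..<k}" "\<pi> n = i + 1" by (auto simp: p(2) S_def)
    have "inv \<pi> i \<notin> {k - p..<k}"
      using \<open>i \<notin> X\<close> permutes_inverses(1)[OF \<pi>, of i] unfolding p(2) S_def by (metis imageI)
    moreover have "inv \<pi> i \<in> {1..k - 1}"
      using permutes_in_image[OF permutes_inv[OF \<pi>], of i] i by simp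
    moreover have "inv \<pi> (i + 1) = n"
      using permutes_inverses(2)[OF \<pi>, of n] n(2) by simp
    ultimately show "inv \<pi> i < inv \<pi> (i + 1)" using n(1) by auto
  qed
  ultimately have face: "\<sigma> \<in> edgewise_subdivision k q" if "\<sigma> \<subseteq> facet k u \<pi>" for \<sigma>
    using that \<pi> unfolding edgewise_subdivision_def by blast
  have "v \<in> facet k u \<pi>" using mem[OF p(1)] p(2) by simp
  moreover have "neighbour k v ` C \<subseteq> facet k u \<pi>"
  proof
    fix x assume "x \<in> neighbour k v ` C"
    then obtain A where A: "A \<in> C" "x = neighbour k v A" by blast
    obtain m where "m < k" "Y A = S m" using suff[of "Y A"] A(1) by auto
    with A show "x \<in> facet k u \<pi>" using mem[of m] nb by simp
  qed
  moreover have "v \<notin> neighbour k v ` C"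
    using neighbour_neq[OF P(4)] by (metis imageE)
  ultimately show ?thesis by (simp add: link_def face)
qed

theorem mainTheorem1:
  fixes k q :: nat and v :: "nat \<Rightarrow> real"
  assumes "k \<ge> 2" and "q \<ge> 1"
    and "v \<in> lattice_W k q"
    and "v \<in> real_space k interior_of simplex_R k q"
  shows "link (edgewise_subdivision k q) {v} \<cong>\<^sub>c barycentric_subdivision (simplex_boundary k) \<and>
         barycentric_subdivision (simplex_boundary k) = order_complex (proper_boolean_lattice k)"
proof -
  have "simplex_boundary k - {{}} = proper_boolean_lattice k"
    by (auto simp: simplex_boundary_def proper_boolean_lattice_def boolean_lattice_def)
  then have bary: "barycentric_subdivision (simplex_boundary k) = order_complex (proper_boolean_lattice k)"
    by (simp add: barycentric_subdivision_def)
  \<comment> \<open>The two inclusions are the two directions above; injectivity of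
    \<open>neighbour k v\<close> on the vertices turns the equality into an isomorphism.\<close>
  have "link (edgewise_subdivision k q) {v}
      = (`) (neighbour k v) ` order_complex (proper_boolean_lattice k)"
    by (intro equalityI subsetI[OF link_simplex_as_neighbours[OF assms(1)]]
        image_subsetI neighbour_simplex_in_link[OF assms(1,3,4)])
  then show ?thesis
    using complex_iso_image[of "neighbour k v" "order_complex (proper_boolean_lattice k)"]
    by (simp only: bary Union_order_complex neighbour_inj simp_thms)
qed

end
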